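(* For every $s \in \mathbb{Z}_{\ge 0}$, the set $\mathcal{G}_s$ is exactly the set of positions whose Grundy number is $s$; that is, for all $(x,y) \in \mathbb{Z}_{\ge 0}\times\mathbb{Z}_{\ge 0}$, $\mathcal{G}(x,y) = s$ if and only if $(x,y) \in \mathcal{G}_s$.
   Context: The game: there are two piles of stones. Each stone in the first pile has weight $1$ and each stone in the second pile has weight $-2$. A position is a pair $(x,y)\in\mathbb{Z}_{\ge 0}\times\mathbb{Z}_{\ge 0}$, where $x$ and $y$ are the numbers of stones in the first and second pile; its total weight is $x-2y$ (possibly negative). Two players alternate; a move removes at least one stone from exactly one pile, and the total weight of the removed stones must be at most $\lfloor \frac{x-2y}{2}\rfloor$. Thus the set of positions reachable in one move is $$\mathrm{move}(x,y) = \{(x-t,y): t\in\mathbb{Z},\ 1\le t \le x,\ t \le \lfloor \tfrac{x-2y}{2}\rfloor\} \cup \{(x,y-u): u\in\mathbb{Z},\ 1\le u\le y,\ -2u \le \lfloor \tfrac{x-2y}{2}\rfloor\}.$$ The player making the last move wins. For a set $S$ of non-negative integers, $\mathrm{mex}(S)$ is the smallest non-negative integer not in $S$. The Grundy number of a position is defined recursively by $\mathcal{G}(x,y) = \mathrm{mex}\{\mathcal{G}(\mathbf{h}) : \mathbf{h} \in \mathrm{move}(x,y)\}$. Sets: for $s,n\in\mathbb{Z}_{\ge 0}$ let $$\mathcal{G}_{s,n} = \{((2s+1)2^n-1+m,\,m): m\in\mathbb{Z}_{\ge 0},\ 0\le m\le (2s+1)2^n-1\}.$$ Let $\mathcal{G}_{0,a}=\mathcal{G}_{0,b}=\emptyset$,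 and for $s\ge 1$ let $$\mathcal{G}_{s,a}=\{(2k,j): k\in\mathbb{Z},\ 0\le k\le s-1,\ 2^{s-k-1}+k\le j\le 2^{s-k}+k-1\},$$ $$\mathcal{G}_{s,b}=\{(2k+1,j): k\in\mathbb{Z},\ 0\le k\le s-1,\ 2^{s-k-1}+k\le j\le 2^{s-k}+k-1\}.$$ Finally $\mathcal{G}_s = \left(\bigcup_{n=0}^{\infty}\mathcal{G}_{s,n}\right)\cup\mathcal{G}_{s,a}\cup\mathcal{G}_{s,b}$. *)

theory Defs
  imports Main
begin

(* A position (x, y) has x stones of weight 1 and y stones of weight -2.  The total weight may be
   negative, so the bound is computed in int, where div 2 rounds towards minus infinity: it is the
   floor of (x - 2 y) / 2.  The numbers t and u of removed stones are positive, hence taken in nat. *)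

definition weight_bound :: "nat \<times> nat \<Rightarrow> int" where
  "weight_bound = (\<lambda>(x, y). (int x - 2 * int y) div 2)"

definition move :: "nat \<times> nat \<Rightarrow> (nat \<times> nat) set" where
  "move = (\<lambda>(x, y).
     {(x - t, y) | t. 1 \<le> t \<and> t \<le> x \<and> int t \<le> weight_bound (x, y)} \<union>
     {(x, y - u) | u. 1 \<le> u \<and> u \<le> y \<and> - 2 * int u \<le> weight_bound (x, y)})"

(* Meaningful for S different from UNIV; below, S is always finite. *)
definition mex :: "nat set \<Rightarrow> nat" where
  "mex S = (LEAST n. n \<notin> S)"

function grundy :: "nat \<times> nat \<Rightarrow> nat" where
  "grundy p = mex (grundy ` move p)"
  by pat_completeness auto

lemma move_decreases: "h \<in> move p \<Longrightarrow> fst h + snd h < fst p + snd p"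
  by (auto simp: move_def split: prod.splits)

termination grundy
  by (relation "measure (\<lambda>p. fst p + snd p)") (auto dest: move_decreases)

(* The defining equation loops as a rewrite rule. *)
declare grundy.simps [simp del]

(* All natural-number subtractions below are exact: the minuends are at least 1, and
   k \<le> s - 1 with s \<ge> 1 gives k + 1 \<le> s. *)

definition G_num :: "nat \<Rightarrow> nat \<Rightarrow> (nat \<times> nat) set" where
  "G_num s n = {((2 * s + 1) * 2 ^ n - 1 + m, m) | m. m \<le> (2 * s + 1) * 2 ^ n - 1}"

definition G_a :: "nat \<Rightarrow> (nat \<times> nat) set" where
  "G_a s = (if s = 0 then {} else
     {(2 * k, j) | k j. k \<le> s - 1 \<and> 2 ^ (s - k - 1) + k \<le> j \<and> j \<le> 2 ^ (s - k) + k - 1})"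

definition G_b :: "nat \<Rightarrow> (nat \<times> nat) set" where
  "G_b s = (if s = 0 then {} else
     {(2 * k + 1, j) | k j. k \<le> s - 1 \<and> 2 ^ (s - k - 1) + k \<le> j \<and> j \<le> 2 ^ (s - k) + k - 1})"

definition G_set :: "nat \<Rightarrow> (nat \<times> nat) set" where
  "G_set s = (\<Union>n. G_num s n) \<union> G_a s \<union> G_b s"

end

theory Submission
  imports Defs
begin

text \<open>
  The sets \<open>G_set s\<close> cover all positions, no move stays inside one of them, and from \<open>G_set s\<close>
  there is a move into \<open>G_set r\<close> for every \<open>r < s\<close>; these three properties characterise the level
  sets of the Grundy function.

  Let \<open>k = x div 2\<close>. If \<open>y \<le> k\<close>, then \<open>d = x + 1 - y\<close> ranges over the integers in
  \<open>((x + 1) div 2, x + 1]\<close>, and moves lead from \<open>d\<close> exactly to the other elements of this interval.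
  An interval \<open>(N div 2, N]\<close> contains exactly one number of the form \<open>(2 * s + 1) * 2 ^ n\<close> for each
  odd \<open>2 * s + 1 \<le> N\<close>. If \<open>y > k\<close>, moves lead exactly to the \<open>(x, y')\<close> with
  \<open>y' - k \<le> (y - k) div 2\<close>: all values \<open>0, \<dots>, k\<close> occur among the \<open>y' \<le> k\<close>, and beyond that the
  value grows with the binary length of \<open>y - k\<close>, which halving decreases.
\<close>

section \<open>Moves and membership as arithmetic conditions\<close>

lemma move_iff:
  "(x', y') \<in> move (x, y) \<longleftrightarrow>
     y' = y \<and> x' < x \<and> x + y \<le> x' + x div 2 \<or>
     x' = x \<and> y' < y \<and> 2 * y' \<le> y + x div 2"
proof -
  have w: "weight_bound (x, y) = int (x div 2) - int y"
    by (simp add: weight_bound_def zdiv_int)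
  have "(\<exists>t. x' = x - t \<and> 1 \<le> t \<and> t \<le> x \<and> int t \<le> int (x div 2) - int y) \<longleftrightarrow>
        x' < x \<and> x + y \<le> x' + x div 2" (is "?L \<longleftrightarrow> ?R")
  proof
    assume ?R
    then show ?L by (intro exI[of _ "x - x'"]) auto
  qed auto
  moreover have "(\<exists>u. y' = y - u \<and> 1 \<le> u \<and> u \<le> y \<and> - 2 * int u \<le> int (x div 2) - int y) \<longleftrightarrow>
        y' < y \<and> 2 * y' \<le> y + x div 2" (is "?L \<longleftrightarrow> ?R")
  proof
    assume ?R
    then show ?L by (intro exI[of _ "y - y'"]) auto
  qed auto
  ultimately show ?thesis
    unfolding move_def prod.case w by blast
qed

text \<open>For \<open>x = N - 1 + y\<close> with \<open>N = (2 * s + 1) * 2 ^ n\<close>, the bound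
  \<open>y \<le> N - 1\<close> says the same as \<open>2 * y \<le> x\<close>.\<close>

lemma in_G_num_iff:
  "(x, y) \<in> G_num s n \<longleftrightarrow> y \<le> x div 2 \<and> x + 1 = (2 * s + 1) * 2 ^ n + y"
proof -
  obtain d where d: "(2 * s + 1) * 2 ^ n = Suc d"
    using gr0_implies_Suc[of "(2 * s + 1) * 2 ^ n"] by auto
  show ?thesis
    unfolding G_num_def d by auto
qed

text \<open>The two families treat even and odd \<open>x\<close> alike through
  \<open>k = x div 2\<close>, so they merge; \<open>b\<close> stands for
  \<open>s - k - 1\<close>.\<close>

lemma in_G_ab_iff:
  "(x, y) \<in> G_a s \<union> G_b s \<longleftrightarrow>
     (\<exists>b. s = x div 2 + Suc b \<and> x div 2 + 2 ^ b \<le> y \<and> y < x div 2 + 2 ^ Suc b)" (is "?L \<longleftrightarrow> ?R")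
proof
  assume ?L
  then have "s \<noteq> 0" by (auto simp: G_a_def G_b_def split: if_splits)
  with \<open>?L\<close> obtain k where k: "x div 2 = k" "k < s" "2 ^ (s - k - 1) + k \<le> y" "y \<le> 2 ^ (s - k) + k - 1"
    by (auto simp: G_a_def G_b_def)
  then obtain b where "s = k + Suc b"
    using less_imp_Suc_add by fastforce
  moreover have "(0::nat) < 2 ^ (s - k)" by simp
  with k have "y < 2 ^ (s - k) + k" by linarith
  ultimately show ?R using k by (auto simp: add.commute)
next
  assume ?R
  then obtain b where b: "s = x div 2 + Suc b" "x div 2 + 2 ^ b \<le> y" "y < x div 2 + 2 ^ Suc b"
    by blast
  define k where "k = x div 2"
  have "x = 2 * k \<or> x = 2 * k + 1" unfolding k_def by arith
  moreover have "s \<noteq> 0" "k \<le> s - 1" "2 ^ (s - k - 1) + k \<le> y" "y \<le> 2 ^ (s - k) + k - 1"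
    using b by (auto simp: k_def)
  ultimately show ?L
    unfolding G_a_def G_b_def by auto
qed

lemma in_G_set_iff:
  "(x, y) \<in> G_set s \<longleftrightarrow>
     y \<le> x div 2 \<and> (\<exists>n. x + 1 = (2 * s + 1) * 2 ^ n + y) \<or>
     (\<exists>b. s = x div 2 + Suc b \<and> x div 2 + 2 ^ b \<le> y \<and> y < x div 2 + 2 ^ Suc b)"
  unfolding G_set_def Un_assoc using in_G_num_iff in_G_ab_iff by blast

section \<open>Odd multiples of powers of two\<close>

lemma odd_times_power2_exists:
  assumes "0 < (d::nat)"
  obtains s n where "d = (2 * s + 1) * 2 ^ n"
proof -
  have "\<exists>s n. d = (2 * s + 1) * 2 ^ n"
    using assms
  proof (induction d rule: less_induct)
    case (less d)
    show ?case
    proof (cases "even d")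
      case True
      then obtain e where "d = 2 * e" by (elim evenE)
      with less obtain s n where "e = (2 * s + 1) * 2 ^ n" by fastforce
      with \<open>d = 2 * e\<close> have "d = (2 * s + 1) * 2 ^ Suc n" by simp
      then show ?thesis by blast
    next
      case False
      then obtain s where "d = (2 * s + 1) * 2 ^ 0" by (auto elim: oddE)
      then show ?thesis by blast
    qed
  qed
  with that show ?thesis by blast
qed

lemma odd_times_power2_inject:
  "(2 * r + 1) * 2 ^ m = (2 * s + 1) * 2 ^ n \<longleftrightarrow> r = s \<and> m = n" for r s :: nat
proof (induction m arbitrary: n)
  case 0
  show ?case
  proof (cases n)
    case (Suc n')
    have "odd ((2 * r + 1) * 2 ^ 0)" and "even ((2 * s + 1) * 2 ^ Suc n')" by auto
    then show ?thesis unfolding Suc by (metis nat.distinct(1))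
  qed auto
next
  case (Suc m)
  show ?case
  proof (cases n)
    case 0
    have "even ((2 * r + 1) * 2 ^ Suc m)" and "odd ((2 * s + 1) * 2 ^ 0)" by auto
    then show ?thesis unfolding 0 by (metis nat.distinct(1))
  next
    case Suc': (Suc n')
    have "(2 * r + 1) * 2 ^ Suc m = (2 * s + 1) * 2 ^ n \<longleftrightarrow>
        2 * ((2 * r + 1) * 2 ^ m) = 2 * ((2 * s + 1) * 2 ^ n')"
      unfolding Suc' power_Suc by (simp only: mult.left_commute)
    also have "\<dots> \<longleftrightarrow> r = s \<and> Suc m = n"
      using Suc.IH[of n'] unfolding Suc' by (simp only: mult_cancel1) simp
    finally show ?thesis .
  qed
qed

lemma mult_power2_less_imp_double_le:
  assumes "c * 2 ^ m < c * 2 ^ n"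
  shows "2 * (c * 2 ^ m) \<le> c * (2::nat) ^ n"
proof -
  have "m < n" using assms by (simp add: mult_less_cancel1)
  then have "(2::nat) ^ Suc m \<le> 2 ^ n" by (intro power_increasing) auto
  then have "c * 2 ^ Suc m \<le> c * 2 ^ n" by (intro mult_le_mono2)
  then show ?thesis by simp
qed

text \<open>Halve \<open>d\<close> until it drops below \<open>2 * c\<close>. For odd
  \<open>c\<close> this picks the number with odd part \<open>c\<close> in the upper half of the
  range up to \<open>d\<close>; \<open>c = 1\<close> gives the binary length of
  \<open>d\<close>.\<close>

lemma power2_bracket:
  assumes "0 < (c::nat)" "c \<le> d"
  obtains n where "c * 2 ^ n \<le> d" "d < c * 2 ^ Suc n"
proof -
  have "\<exists>n. c * 2 ^ n \<le> d \<and> d < c * 2 ^ Suc n"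
    using assms(2)
  proof (induction d rule: less_induct)
    case (less d)
    show ?case
    proof (cases "d < 2 * c")
      case True
      with less.prems show ?thesis by (intro exI[of _ 0]) auto
    next
      case False
      with assms(1) have "d div 2 < d" "c \<le> d div 2" by auto
      then obtain n where "c * 2 ^ n \<le> d div 2" "d div 2 < c * 2 ^ Suc n"
        using less.IH by blast
      then have "c * 2 ^ Suc n \<le> d" "d < c * 2 ^ Suc (Suc n)" by auto
      then show ?thesis by blast
    qed
  qed
  with that show ?thesis by blast
qed

section \<open>Covering, independence and absorption\<close>

lemma G_set_cover:
  obtains s where "(x, y) \<in> G_set s"
proof (cases "y \<le> x div 2")
  case True
  then have "0 < x + 1 - y" by linarith
  then obtain s n where "x + 1 - y = (2 * s + 1) * 2 ^ n"
    by (rule odd_times_power2_exists)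
  with True have "x + 1 = (2 * s + 1) * 2 ^ n + y" by linarith
  with True that show ?thesis by (meson in_G_set_iff)
next
  case False
  then have "1 \<le> y - x div 2" by linarith
  then obtain b where "1 * 2 ^ b \<le> y - x div 2" "y - x div 2 < 1 * 2 ^ Suc b"
    by (rule power2_bracket[OF zero_less_one])
  then have "x div 2 + 2 ^ b \<le> y" "y < x div 2 + 2 ^ Suc b"
    using False by linarith+
  with that show ?thesis by (meson in_G_set_iff)
qed

text \<open>Since \<open>2 * s + 1 \<le> x + 1\<close>, values here are at most
  \<open>x div 2\<close>, whereas in \<open>G_set_high\<close> they exceed it; so the two regions of
  a column share no value.\<close>

lemma G_set_low:
  assumes "(x, y) \<in> G_set s" "y \<le> x div 2"
  obtains n where "x + 1 = (2 * s + 1) * 2 ^ n + y" "s \<le> x div 2"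
proof -
  have "\<not> x div 2 + 2 ^ b \<le> y" for b
    using assms(2) by (simp add: not_le trans_le_add1 le_less_trans)
  then obtain n where n: "x + 1 = (2 * s + 1) * 2 ^ n + y"
    using assms(1) unfolding in_G_set_iff by blast
  have "(2 * s + 1) * 1 \<le> (2 * s + 1) * 2 ^ n" by (intro mult_le_mono2) simp
  with n have "2 * s \<le> x" unfolding mult_1_right by linarith
  then have "s \<le> x div 2" by simp
  with n that show ?thesis by blast
qed

lemma G_set_high:
  assumes "(x, y) \<in> G_set s" "\<not> y \<le> x div 2"
  obtains b where "s = x div 2 + Suc b" "x div 2 + 2 ^ b \<le> y" "y < x div 2 + 2 * 2 ^ b"
  using assms unfolding in_G_set_iff power_Suc by blast

lemma G_set_independent:
  assumes p: "(x, y) \<in> G_set s" and mv: "(x', y') \<in> move (x, y)"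
  shows "(x', y') \<notin> G_set s"
proof
  assume p': "(x', y') \<in> G_set s"
  show False
  proof (cases "y \<le> x div 2")
    case True
    from True mv have low': "y' \<le> x' div 2"
      unfolding move_iff by auto
    obtain n where n: "x + 1 = (2 * s + 1) * 2 ^ n + y" by (rule G_set_low[OF p True])
    obtain n' where n': "x' + 1 = (2 * s + 1) * 2 ^ n' + y'" by (rule G_set_low[OF p' low'])
    define d where "d = (2 * s + 1) * 2 ^ n"
    define d' where "d' = (2 * s + 1) * 2 ^ n'"
    \<comment> \<open>Distinct numbers with the same odd part differ by a factor of at least 2, but
      the move changes \<open>d\<close> to \<open>d'\<close> by a factor below 2.\<close>
    have "d < d' \<Longrightarrow> 2 * d \<le> d'" "d' < d \<Longrightarrow> 2 * d' \<le> d"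
      unfolding d_def d'_def by (rule mult_power2_less_imp_double_le; assumption)+
    with n n' mv True low' show False
      unfolding move_iff d_def[symmetric] d'_def[symmetric] by linarith
  next
    case False
    \<comment> \<open>The weight bound is negative, so only the second pile can shrink, and the
      excess of \<open>y\<close> over \<open>x div 2\<close> at least halves: \<open>y'\<close>
      falls below the block of \<open>s\<close>.\<close>
    then have mv': "x' = x" "2 * y' \<le> y + x div 2"
      using mv unfolding move_iff by auto
    obtain b where b: "s = x div 2 + Suc b" "y < x div 2 + 2 * 2 ^ b"
      by (rule G_set_high[OF p False])
    show False
    proof (cases "y' \<le> x' div 2")
      case True
      obtain n where "s \<le> x' div 2" by (rule G_set_low[OF p' True])
      with b mv' show False by simp
    next
      case False
      obtain b' where "s = x' div 2 + Suc b'" "x' div 2 + 2 ^ b' \<le> y'"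
        by (rule G_set_high[OF p' False])
      with b mv' show False by simp
    qed
  qed
qed

lemma G_set_absorbing:
  assumes p: "(x, y) \<in> G_set s" and "r < s"
  obtains h where "h \<in> move (x, y)" "h \<in> G_set r"
proof (cases "r \<le> x div 2")
  case True
  then have "2 * r + 1 \<le> x + 1" by linarith
  then obtain m where m: "(2 * r + 1) * 2 ^ m \<le> x + 1" "x + 1 < (2 * r + 1) * 2 ^ Suc m"
    using power2_bracket[of "2 * r + 1" "x + 1"] by auto
  define d where "d = (2 * r + 1) * 2 ^ m"
  have d: "d \<le> x + 1" "x + 1 < 2 * d" using m by (simp_all add: d_def)
  define y' where "y' = x + 1 - d"
  have y': "y' \<le> x div 2" "x + 1 = d + y'" using d by (auto simp: y'_def)
  show ?thesis
  proof (cases "y \<le> x div 2")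
    case low: True
    obtain n where n: "x + 1 = (2 * s + 1) * 2 ^ n + y" by (rule G_set_low[OF p low])
    \<comment> \<open>The odd parts \<open>2 * r + 1\<close> and \<open>2 * s + 1\<close> differ, so
      the target \<open>d\<close> is not the current \<open>x + 1 - y\<close>.\<close>
    have "d \<noteq> (2 * s + 1) * 2 ^ n"
      using \<open>r < s\<close> odd_times_power2_inject[of r m s n] by (simp add: d_def)
    with n y' have "y' \<noteq> y" by linarith
    then consider "y' < y" | "y < y'" by linarith
    then show ?thesis
    proof cases
      case 1
      then have "(x, y') \<in> move (x, y)" using y' by (simp add: move_iff)
      moreover have "(x, y') \<in> G_set r" using y' by (auto simp: in_G_set_iff d_def)
      ultimately show ?thesis by (rule that)
    next
      case 2
      \<comment> \<open>Lowering \<open>y\<close> to \<open>y'\<close> is impossible here; removing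
        \<open>y' - y\<close> stones from the first pile reaches the same \<open>d\<close>.\<close>
      define x' where "x' = x - (y' - y)"
      have x': "x' + 1 = d + y" "x' < x" "y \<le> x' div 2" "x + y \<le> x' + x div 2"
        using 2 low y' unfolding x'_def by linarith+
      have "(x', y) \<in> move (x, y)" using x' by (simp add: move_iff)
      moreover have "(x', y) \<in> G_set r" using x' by (auto simp: in_G_set_iff d_def)
      ultimately show ?thesis by (rule that)
    qed
  next
    case False
    then have "(x, y') \<in> move (x, y)" using y' by (simp add: move_iff)
    moreover have "(x, y') \<in> G_set r" using y' by (auto simp: in_G_set_iff d_def)
    ultimately show ?thesis by (rule that)
  qed
next
  case False
  have "\<not> y \<le> x div 2"
  proof
    assume "y \<le> x div 2"
    then have "s \<le> x div 2" using G_set_low[OF p] by blast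
    with False \<open>r < s\<close> show False by simp
  qed
  then obtain b where b: "s = x div 2 + Suc b" "x div 2 + 2 ^ b \<le> y"
    by (rule G_set_high[OF p])
  obtain c where c: "r = x div 2 + Suc c"
    using False less_imp_Suc_add[of "x div 2" r] by auto
  have "(2::nat) ^ Suc c \<le> 2 ^ b"
    using b c \<open>r < s\<close> by (intro power_increasing) auto
  moreover have "(0::nat) < 2 ^ c" by simp
  ultimately have "2 ^ c < (2::nat) ^ b" "2 * 2 ^ c \<le> (2::nat) ^ b"
    unfolding power_Suc by linarith+
  \<comment> \<open>The target is the lowest point of the block of \<open>r\<close>;
    \<open>c < b\<close> puts it within half the excess of \<open>y\<close>.\<close>
  with b(2) have "x div 2 + 2 ^ c < y" "2 * (x div 2 + 2 ^ c) \<le> y + x div 2"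
    unfolding add_mult_distrib2 by linarith+
  then have "(x, x div 2 + 2 ^ c) \<in> move (x, y)" by (simp add: move_iff)
  moreover have "(x, x div 2 + 2 ^ c) \<in> G_set r" using c by (auto simp: in_G_set_iff)
  ultimately show ?thesis by (rule that)
qed

section \<open>From the three properties to Grundy numbers\<close>

lemma mex_eqI:
  assumes "s \<notin> S" "\<And>r. r < s \<Longrightarrow> r \<in> S"
  shows "mex S = s"
  unfolding mex_def using assms by (intro Least_equality) (auto simp: not_less[symmetric])

lemma grundy_of_G_set: "p \<in> G_set s \<Longrightarrow> grundy p = s"
proof (induction "fst p + snd p" arbitrary: p s rule: less_induct)
  case less
  obtain x y where p: "p = (x, y)" by (cases p)
  have IH: "grundy h = t" if "h \<in> move p" "h \<in> G_set t" for h t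
    using less.hyps[OF move_decreases[OF that(1)] that(2)] .
  have "mex (grundy ` move p) = s"
  proof (rule mex_eqI)
    show "s \<notin> grundy ` move p"
    proof
      assume "s \<in> grundy ` move p"
      then obtain x' y' where h: "(x', y') \<in> move p" "grundy (x', y') = s" by auto
      \<comment> \<open>Covering places the option in some \<open>G_set t\<close>; the induction
        hypothesis then forces \<open>t = s\<close>.\<close>
      obtain t where "(x', y') \<in> G_set t" by (rule G_set_cover)
      with IH h have "(x', y') \<in> G_set s" by blast
      with G_set_independent h less.prems show False unfolding p by blast
    qed
  next
    fix r assume "r < s"
    with less.prems obtain h where "h \<in> move p" "h \<in> G_set r"
      unfolding p by (rule G_set_absorbing)
    with IH show "r \<in> grundy ` move p" by blast
  qed
  then show ?case by (subst grundy.simps)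
qed

theorem theorem1p1:
  fixes s x y :: nat
  shows "grundy (x, y) = s \<longleftrightarrow> (x, y) \<in> G_set s"
proof
  assume g: "grundy (x, y) = s"
  obtain t where t: "(x, y) \<in> G_set t" by (rule G_set_cover)
  with g show "(x, y) \<in> G_set s" by (simp add: grundy_of_G_set[OF t])
qed (rule grundy_of_G_set)

end
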